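(* Assume that $P(x,y)>0$ for all $x,y\in X$ and that there is a constant $C_*\ge 1$ with $P_2(x,y)\le C_*P(x,y)$ for all $x,y\in X$; that $\inf_{x\in X}P(x,x)>0$; that $\sup_{x,y\in X}P(x,y)/\mu(y)<\infty$; and that the potential $V$ is confining. Then the aIUC and IHC properties are equivalent, i.e. the semigroup $\{\mathcal U_n:n\in\mathbb N_0\}$ is aIUC if and only if it is IHC.
   Context: $X$ is a countably infinite set, $\mathbb N=\{1,2,\dots\}$, $\mathbb N_0=\mathbb N\cup\{0\}$. $P:X\times X\to[0,1]$ is a (sub-)probability kernel, i.e. $\sum_{y\in X}P(x,y)\le1$ for all $x$. It is assumed throughout that there are a (sub-)probability kernel $\widehat P:X\times X\to[0,1]$ and a measure $\mu:X\to(0,\infty)$ with $\mu(x)P(x,y)=\mu(y)\widehat P(y,x)$ for all $x,y\in X$. Put $P_2(x,y)=\sum_{z\in X}P(x,z)P(z,y)$. A potential is a function $V:X\to(0,\infty)$ with $\inf_{x\in X}V(x)>0$ (standing assumption). It is confining if for every $M\in\mathbb N$ there is a finite set $B_M\subset X$ with $V(x)\ge M$ for all $x\in X\setminus B_M$. Let $\mathcal U f(x)=\frac1{V(x)}\sum_{y}P(x,y)f(y)$ and $\widehat{\mathcal U}f(x)=\sum_y\widehat P(x,y)\frac1{V(y)}f(y)$; these are mutually adjoint on $\ell^2(\mu)$. Let $\mathcal U_n=\mathcal U^n$. Under the hypotheses of the claim, $\mathcal U,\widehat{\mathcal U}$ are compact on $\ell^2(\mu)$ and $\lambda_0:=\sup_{\lambda\in\sigma(\mathcal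 U)}|\lambda|=\sup_{\lambda\in\sigma(\widehat{\mathcal U})}|\lambda|>0$ is a simple eigenvalue of both; $\varphi_0,\widehat\varphi_0$ denote the corresponding strictly positive eigenfunctions, $\mathcal U\varphi_0=\lambda_0\varphi_0$, $\widehat{\mathcal U}\widehat\varphi_0=\lambda_0\widehat\varphi_0$, normalized by $\|\varphi_0\|_{\ell^2(\mu)}=\|\widehat\varphi_0\|_{\ell^2(\mu)}=1$. Let $\nu(x)=\varphi_0(x)\widehat\varphi_0(x)\mu(x)$ (a finite measure) and $\mathcal Q_nf=\lambda_0^{-n}\varphi_0^{-1}\,\mathcal U_n(f\varphi_0)$ (the intrinsic semigroup). aIUC (asymptotic intrinsic ultracontractivity): there is $n_0\in\mathbb N$ such that $\mathcal Q_{n_0}:\ell^1(\nu)\to\ell^\infty(\nu)$ is bounded. IHC (intrinsic hypercontractivity): for every $1<p<q<\infty$ there is $n=n_{p,q}\in\mathbb N$ such that $\mathcal Q_n:\ell^p(\nu)\to\ell^q(\nu)$ is bounded. *)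

theory Defs
  imports "HOL-Analysis.Analysis"
begin

text \<open>The countably infinite state space is the universe of a type \<open>'a\<close>. A measure on it is
  given by its point masses. All measures below charge every point, so functions need not be
  identified up to null sets and the essential supremum is a plain supremum.\<close>

definition sub_prob_kernel :: "('a \<Rightarrow> 'a \<Rightarrow> real) \<Rightarrow> bool" where
  "sub_prob_kernel P \<longleftrightarrow>
     (\<forall>x y. 0 \<le> P x y \<and> P x y \<le> 1) \<and>
     (\<forall>x. P x summable_on UNIV \<and> (\<Sum>\<^sub>\<infinity>y. P x y) \<le> 1)"

definition two_step :: "('a \<Rightarrow> 'a \<Rightarrow> real) \<Rightarrow> 'a \<Rightarrow> 'a \<Rightarrow> real" where
  "two_step P x y = (\<Sum>\<^sub>\<infinity>z. P x z * P z y)"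

definition potential :: "('a \<Rightarrow> real) \<Rightarrow> bool" where
  "potential V \<longleftrightarrow> (\<forall>x. V x > 0) \<and> (INF x. V x) > 0"

definition confining :: "('a \<Rightarrow> real) \<Rightarrow> bool" where
  "confining V \<longleftrightarrow> (\<forall>M::nat. M \<ge> 1 \<longrightarrow> (\<exists>B. finite B \<and> (\<forall>x. x \<notin> B \<longrightarrow> V x \<ge> real M)))"

definition lp_space :: "('a \<Rightarrow> real) \<Rightarrow> real \<Rightarrow> ('a \<Rightarrow> 'b::real_normed_vector) set" where
  "lp_space m p = {f. (\<lambda>x. norm (f x) powr p * m x) summable_on UNIV}"

definition lp_norm :: "('a \<Rightarrow> real) \<Rightarrow> real \<Rightarrow> ('a \<Rightarrow> 'b::real_normed_vector) \<Rightarrow> real" where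
  "lp_norm m p f = (\<Sum>\<^sub>\<infinity>x. norm (f x) powr p * m x) powr (1 / p)"

definition linf_space :: "('a \<Rightarrow> 'b::real_normed_vector) set" where
  "linf_space = {f. bounded (range f)}"

definition linf_norm :: "('a \<Rightarrow> 'b::real_normed_vector) \<Rightarrow> real" where
  "linf_norm f = (SUP x. norm (f x))"

definition bounded_between ::
  "'f set \<Rightarrow> ('f \<Rightarrow> real) \<Rightarrow> 'g set \<Rightarrow> ('g \<Rightarrow> real) \<Rightarrow> ('f \<Rightarrow> 'g) \<Rightarrow> bool" where
  "bounded_between E nE F nF T \<longleftrightarrow> (\<exists>C. \<forall>f\<in>E. T f \<in> F \<and> nF (T f) \<le> C * nE f)"

text \<open>The operators act on real-valued and on complex-valued functions; the latter are needed
  for the spectrum.\<close>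

definition fk_op :: "('a \<Rightarrow> 'a \<Rightarrow> real) \<Rightarrow> ('a \<Rightarrow> real) \<Rightarrow>
    ('a \<Rightarrow> 'b::real_normed_vector) \<Rightarrow> 'a \<Rightarrow> 'b" where
  "fk_op P V f x = (1 / V x) *\<^sub>R (\<Sum>\<^sub>\<infinity>y. P x y *\<^sub>R f y)"

definition fk_dual_op :: "('a \<Rightarrow> 'a \<Rightarrow> real) \<Rightarrow> ('a \<Rightarrow> real) \<Rightarrow>
    ('a \<Rightarrow> 'b::real_normed_vector) \<Rightarrow> 'a \<Rightarrow> 'b" where
  "fk_dual_op Ph V f x = (\<Sum>\<^sub>\<infinity>y. (Ph x y * (1 / V y)) *\<^sub>R f y)"

definition l2_resolvent_set ::
  "('a \<Rightarrow> real) \<Rightarrow> (('a \<Rightarrow> complex) \<Rightarrow> 'a \<Rightarrow> complex) \<Rightarrow> complex set" where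
  "l2_resolvent_set m T = {z.
     let E = lp_space m 2; S = (\<lambda>f x. z * f x - T f x)
     in bij_betw S E E \<and> bounded_between E (lp_norm m 2) E (lp_norm m 2) (inv_into E S)}"

definition l2_spectrum ::
  "('a \<Rightarrow> real) \<Rightarrow> (('a \<Rightarrow> complex) \<Rightarrow> 'a \<Rightarrow> complex) \<Rightarrow> complex set" where
  "l2_spectrum m T = - l2_resolvent_set m T"

text \<open>The supremum is one of a nonempty bounded set, because for sub-probability kernels in
  duality and \<open>inf V > 0\<close> the operator is bounded on the complex Hilbert space.\<close>

definition lambda0 :: "('a \<Rightarrow> 'a \<Rightarrow> real) \<Rightarrow> ('a \<Rightarrow> real) \<Rightarrow> ('a \<Rightarrow> real) \<Rightarrow> real" where
  "lambda0 P V m = (SUP z \<in> l2_spectrum m (fk_op P V). cmod z)"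

definition normalized_pos_eigenfunction :: "('a \<Rightarrow> real) \<Rightarrow> (('a \<Rightarrow> real) \<Rightarrow> 'a \<Rightarrow> real) \<Rightarrow>
    real \<Rightarrow> ('a \<Rightarrow> real) \<Rightarrow> bool" where
  "normalized_pos_eigenfunction m T l phi \<longleftrightarrow>
     (\<forall>x. phi x > 0) \<and> phi \<in> lp_space m 2 \<and> lp_norm m 2 phi = 1 \<and> (\<forall>x. T phi x = l * phi x)"

definition nu :: "('a \<Rightarrow> real) \<Rightarrow> ('a \<Rightarrow> real) \<Rightarrow> ('a \<Rightarrow> real) \<Rightarrow> 'a \<Rightarrow> real" where
  "nu m phi phih x = phi x * phih x * m x"

definition intrinsic_op :: "('a \<Rightarrow> 'a \<Rightarrow> real) \<Rightarrow> ('a \<Rightarrow> real) \<Rightarrow> ('a \<Rightarrow> real) \<Rightarrow> ('a \<Rightarrow> real) \<Rightarrow>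
    nat \<Rightarrow> ('a \<Rightarrow> real) \<Rightarrow> 'a \<Rightarrow> real" where
  "intrinsic_op P V m phi n f x =
     (fk_op P V ^^ n) (\<lambda>y. f y * phi y) x / (lambda0 P V m ^ n * phi x)"

definition aIUC :: "('a \<Rightarrow> 'a \<Rightarrow> real) \<Rightarrow> ('a \<Rightarrow> real) \<Rightarrow> ('a \<Rightarrow> real) \<Rightarrow>
    ('a \<Rightarrow> real) \<Rightarrow> ('a \<Rightarrow> real) \<Rightarrow> bool" where
  "aIUC P V m phi phih \<longleftrightarrow> (\<exists>n\<ge>1.
     bounded_between (lp_space (nu m phi phih) 1) (lp_norm (nu m phi phih) 1)
       linf_space linf_norm (intrinsic_op P V m phi n))"

definition IHC :: "('a \<Rightarrow> 'a \<Rightarrow> real) \<Rightarrow> ('a \<Rightarrow> real) \<Rightarrow> ('a \<Rightarrow> real) \<Rightarrow>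
    ('a \<Rightarrow> real) \<Rightarrow> ('a \<Rightarrow> real) \<Rightarrow> bool" where
  "IHC P V m phi phih \<longleftrightarrow> (\<forall>p q. 1 < p \<and> p < q \<longrightarrow> (\<exists>n\<ge>1.
     bounded_between (lp_space (nu m phi phih) p) (lp_norm (nu m phi phih) p)
       (lp_space (nu m phi phih) q) (lp_norm (nu m phi phih) q) (intrinsic_op P V m phi n)))"

end

theory Submission
  imports Defs
begin

text \<open>
  That aIUC implies IHC is immediate, since \<open>\<nu>\<close> is finite. Conversely, testing the boundedness of
  \<open>\<Q>\<^sub>n\<close> from \<open>\<ell>\<^sup>2(\<nu>)\<close> to \<open>\<ell>\<^sup>4(\<nu>)\<close> on indicators of points, and bounding \<open>\<U>\<^sub>n\<close> from below by its
  diagonal contribution \<open>(P(x,x) / V(x))\<^sup>n\<close>, gives \<open>V\<^sup>-\<^sup>N \<le> A \<nu>\<close> with \<open>N = 4n\<close>. The condition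
  \<open>P\<^sub>2 \<le> C P\<close> allows one to collect all the factors \<open>1/V(z\<^sub>i)\<close> along a path at a single intermediate
  point, which bounds the kernel of \<open>\<U>\<close> raised to the power \<open>N + 2\<close> by a multiple of
  \<open>V(x)\<^sup>-\<^sup>1 (\<Sum>z. P(x,z) V(z)\<^sup>-\<^sup>(\<^sup>N\<^sup>+\<^sup>1\<^sup>) P(z,y))\<close>. Replacing \<open>V(z)\<^sup>-\<^sup>N\<close> by \<open>A \<phi>(z) \<phi>h(z) \<mu>(z)\<close> and using the eigenvalue
  equations of \<open>\<phi>\<close> and \<open>\<phi>h\<close>, this is at most a multiple of \<open>\<phi>(x) \<phi>h(y) \<mu>(y)\<close>, which is aIUC.
\<close>

section \<open>Infinite sums as integrals over counting measure\<close>

lemma nn_integral_count_space_conv_infsum: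
  fixes f :: "'a \<Rightarrow> real"
  assumes "f summable_on A" and "\<And>x. x \<in> A \<Longrightarrow> f x \<ge> 0"
  shows "(\<integral>\<^sup>+x. ennreal (f x) \<partial>count_space A) = ennreal (infsum f A)"
proof -
  have "Infinite_Set_Sum.abs_summable_on f A"
    using summable_on_iff_abs_summable_on_real abs_summable_equivalent assms(1) by blast
  from nn_integral_conv_infsetsum[OF this assms(2)] infsetsum_infsum[OF this]
  show ?thesis by simp
qed

text \<open>If \<open>f\<close> is not summable, \<open>infsum\<close> takes its default value 0 and
  the bound is trivial. Upper estimates of iterated sums can therefore be carried out in
  \<open>ennreal\<close> with no convergence checks.\<close>

lemma abs_infsum_le_nn_integral:
  fixes f :: "'a \<Rightarrow> real"
  shows "ennreal \<bar>infsum f A\<bar> \<le> (\<integral>\<^sup>+x. ennreal \<bar>f x\<bar> \<partial>count_space A)"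
proof (cases "f summable_on A")
  case True
  then have abs: "(\<lambda>x. \<bar>f x\<bar>) summable_on A"
    using summable_on_iff_abs_summable_on_real[of f A] by simp
  then show ?thesis
    using norm_infsum_bound[of f A]
    by (auto simp: nn_integral_count_space_conv_infsum intro!: ennreal_leI)
qed (simp add: infsum_not_exists)

lemma term_le_infsum:
  fixes f :: "'a \<Rightarrow> real"
  assumes "f summable_on UNIV" and "\<And>x. f x \<ge> 0"
  shows "f x \<le> infsum f UNIV"
  using finite_sum_le_infsum[of f UNIV "{x}"] assms by simp

text \<open>Tonelli: both iterated integrals equal the integral over the counting measure on the
  product type.\<close>

lemma nn_integral_count_space_swap:
  fixes f :: "'a \<Rightarrow> 'b \<Rightarrow> ennreal"
  shows "(\<integral>\<^sup>+x. \<integral>\<^sup>+y. f x y \<partial>count_space UNIV \<partial>count_space UNIV) =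
    (\<integral>\<^sup>+y. \<integral>\<^sup>+x. f x y \<partial>count_space UNIV \<partial>count_space UNIV)"
  using nn_integral_fst_count_space[of "\<lambda>(x, y). f x y"]
    nn_integral_snd_count_space[of "\<lambda>(x, y). f x y"] by simp

section \<open>Nonnegative kernel operators and the domination of two steps by one\<close>

text \<open>Takes values in \<open>ennreal\<close>, so that additivity, monotonicity and interchange
  of sums hold unconditionally.\<close>

definition kernel_nn :: "('a \<Rightarrow> 'b \<Rightarrow> real) \<Rightarrow> ('b \<Rightarrow> ennreal) \<Rightarrow> 'a \<Rightarrow> ennreal" where
  "kernel_nn P g x = (\<integral>\<^sup>+y. ennreal (P x y) * g y \<partial>count_space UNIV)"

lemma kernel_nn_mono: "(\<And>y. g y \<le> h y) \<Longrightarrow> kernel_nn P g x \<le> kernel_nn P h x"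
  unfolding kernel_nn_def by (intro nn_integral_mono mult_left_mono) auto

lemma kernel_nn_cmult: "kernel_nn P (\<lambda>y. c * g y) x = c * kernel_nn P g x"
  unfolding kernel_nn_def by (subst nn_integral_cmult[symmetric]) (auto simp: ac_simps)

lemma kernel_nn_add: "kernel_nn P (\<lambda>y. g y + h y) x = kernel_nn P g x + kernel_nn P h x"
  unfolding kernel_nn_def by (subst nn_integral_add[symmetric]) (auto simp: algebra_simps)

text \<open>By Tonelli, applying the kernel twice integrates \<open>g\<close> against
  \<open>two_step P x\<close>, which is at most \<open>C\<close> times \<open>P x\<close>.\<close>

lemma kernel_nn_two_step:
  assumes P: "sub_prob_kernel P" and C: "C \<ge> 0" "\<And>x y. two_step P x y \<le> C * P x y"
  shows "kernel_nn P (kernel_nn P g) x \<le> ennreal C * kernel_nn P g x"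
proof -
  have P0: "P x y \<ge> 0" and P1: "P x y \<le> 1" and Ps: "P x summable_on UNIV" for x y
    using P by (auto simp: sub_prob_kernel_def)
  have two: "(\<integral>\<^sup>+w. ennreal (P x w) * ennreal (P w y) \<partial>count_space UNIV) \<le> ennreal (C * P x y)"
    for y
  proof -
    have "(\<lambda>w. P x w * P w y) summable_on UNIV"
      by (rule summable_on_comparison_test[OF Ps[of x]]) (auto intro: mult_left_le mult_nonneg_nonneg P0 P1)
    then have "(\<integral>\<^sup>+w. ennreal (P x w * P w y) \<partial>count_space UNIV) = ennreal (two_step P x y)"
      unfolding two_step_def by (intro nn_integral_count_space_conv_infsum) (auto simp: P0)
    then show ?thesis
      using C(2)[of x y] P0 by (simp add: ennreal_leI flip: ennreal_mult)
  qed
  have "kernel_nn P (kernel_nn P g) x =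
      (\<integral>\<^sup>+w. \<integral>\<^sup>+y. ennreal (P x w) * ennreal (P w y) * g y \<partial>count_space UNIV \<partial>count_space UNIV)"
    unfolding kernel_nn_def by (subst nn_integral_cmult[symmetric]) (auto simp: ac_simps)
  also have "\<dots> = (\<integral>\<^sup>+y. (\<integral>\<^sup>+w. ennreal (P x w) * ennreal (P w y) \<partial>count_space UNIV) * g y \<partial>count_space UNIV)"
    by (subst nn_integral_count_space_swap) (simp add: nn_integral_multc)
  also have "\<dots> \<le> (\<integral>\<^sup>+y. ennreal (C * P x y) * g y \<partial>count_space UNIV)"
    by (intro nn_integral_mono mult_right_mono two) auto
  also have "\<dots> = ennreal C * kernel_nn P g x"
    unfolding kernel_nn_def using C(1)
    by (subst nn_integral_cmult[symmetric]) (auto simp: ennreal_mult' ac_simps)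
  finally show ?thesis .
qed

lemma abs_fk_op_le_kernel_nn:
  assumes "\<And>x y. P x y \<ge> 0" and "\<And>x. V x > 0"
  shows "ennreal \<bar>fk_op P V f x\<bar> \<le> ennreal (1 / V x) * kernel_nn P (\<lambda>y. ennreal \<bar>f y\<bar>) x"
proof -
  have "ennreal \<bar>fk_op P V f x\<bar> = ennreal (1 / V x) * ennreal \<bar>\<Sum>\<^sub>\<infinity>y. P x y * f y\<bar>"
    using assms(2)[of x] by (simp add: fk_op_def abs_mult flip: ennreal_mult)
  also have "\<dots> \<le> ennreal (1 / V x) * (\<integral>\<^sup>+y. ennreal \<bar>P x y * f y\<bar> \<partial>count_space UNIV)"
    by (intro mult_left_mono abs_infsum_le_nn_integral) auto
  also have "\<dots> = ennreal (1 / V x) * kernel_nn P (\<lambda>y. ennreal \<bar>f y\<bar>) x"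
    using assms(1) by (simp add: kernel_nn_def abs_mult ennreal_mult)
  finally show ?thesis .
qed

section \<open>Upper bounds for iterates of the Feynman-Kac operator\<close>

text \<open>The product is at most the larger of \<open>a\<close> and \<open>b\<close> to the power
  \<open>n + 1\<close>. This moves potential factors located at two points of a path to a single one
  of them.\<close>

lemma mult_power_le_sum_powers:
  fixes a b :: real
  assumes "a \<ge> 0" "b \<ge> 0"
  shows "a * b ^ n \<le> a ^ Suc n + b ^ Suc n"
proof (cases "a \<le> b")
  case True
  then have "a * b ^ n \<le> b * b ^ n" using assms by (intro mult_right_mono) auto
  then show ?thesis using zero_le_power[OF assms(1), of "Suc n"] by simp
next
  case False
  then have "a * b ^ n \<le> a * a ^ n" using assms by (intro mult_left_mono power_mono) auto
  then show ?thesis using zero_le_power[OF assms(2), of "Suc n"] by simp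
qed

text \<open>Induction on \<open>n\<close>: one more application of the operator puts a factor
  \<open>1 / V w\<close> next to \<open>(1 / V z) ^ (n + 1)\<close>. The product is split into a
  power at \<open>w\<close> plus a power at \<open>z\<close>; in each summand one step of the path
  has become free of potential and is absorbed by the two-step bound. Two summands at the cost of
  \<open>C\<close> each give the factor \<open>2 * C\<close>.\<close>

lemma fk_op_iterate_bound:
  fixes P :: "'a \<Rightarrow> 'a \<Rightarrow> real" and f :: "'a \<Rightarrow> real"
  assumes P: "sub_prob_kernel P" and C: "C \<ge> 0" "\<And>x y. two_step P x y \<le> C * P x y"
    and V: "\<And>x. V x > 0"
  shows "ennreal \<bar>(fk_op P V ^^ (n + 2)) f x\<bar> \<le> ennreal ((2 * C) ^ n * (1 / V x)) *
    kernel_nn P (\<lambda>z. ennreal ((1 / V z) ^ (n + 1)) * kernel_nn P (\<lambda>y. ennreal \<bar>f y\<bar>) z) x"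
    (is "_ \<le> _ * ?A n x")
proof -
  note le = abs_fk_op_le_kernel_nn[OF _ V, of P]
  have P0: "P x y \<ge> 0" for x y using P by (auto simp: sub_prob_kernel_def)
  have W0: "1 / V x \<ge> 0" for x using V[of x] by simp
  show ?thesis
  proof (induction n arbitrary: x)
    case 0
    have "ennreal \<bar>fk_op P V (fk_op P V f) x\<bar> \<le>
        ennreal (1 / V x) * kernel_nn P (\<lambda>z. ennreal \<bar>fk_op P V f z\<bar>) x"
      by (rule le) (rule P0)
    also have "\<dots> \<le> ennreal (1 / V x) * ?A 0 x"
      using le[OF P0] by (intro mult_left_mono kernel_nn_mono) auto
    finally show ?case by (simp add: numeral_2_eq_2)
  next
    case (Suc n)
    let ?F = "kernel_nn P (\<lambda>y. ennreal \<bar>f y\<bar>)"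
    let ?W = "\<lambda>k z. ennreal ((1 / V z) ^ k)"
    let ?D = "(2 * C) ^ n"
    have split: "?W 1 w * (?W (n + 1) z * g) \<le> ?W (n + 2) w * g + ?W (n + 2) z * g" for w z g
    proof -
      have "?W 1 w * ?W (n + 1) z \<le> ?W (n + 2) w + ?W (n + 2) z"
        using mult_power_le_sum_powers[of "1 / V w" "1 / V z" "n + 1"] W0[of w] W0[of z]
        by (simp del: power_Suc flip: ennreal_mult ennreal_plus)
      from mult_right_mono[OF this, of g] show ?thesis
        by (simp add: algebra_simps)
    qed
    have inner: "?W 1 w * ?A n w \<le> ?W (n + 2) w * kernel_nn P ?F w + kernel_nn P (\<lambda>z. ?W (n + 2) z * ?F z) w" for w
    proof -
      have "?W 1 w * ?A n w = kernel_nn P (\<lambda>z. ?W 1 w * (?W (n + 1) z * ?F z)) w"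
        by (simp add: kernel_nn_cmult)
      also have "\<dots> \<le> kernel_nn P (\<lambda>z. ?W (n + 2) w * ?F z + ?W (n + 2) z * ?F z) w"
        by (intro kernel_nn_mono split)
      finally show ?thesis by (simp add: kernel_nn_add kernel_nn_cmult)
    qed
    \<comment> \<open>All factors sit at \<open>w\<close>, so the two steps after \<open>w\<close>
      merge into one.\<close>
    have "kernel_nn P (\<lambda>w. ?W (n + 2) w * kernel_nn P ?F w) x \<le>
        kernel_nn P (\<lambda>w. ennreal C * (?W (n + 2) w * ?F w)) x"
    proof (intro kernel_nn_mono)
      fix w
      have "?W (n + 2) w * kernel_nn P ?F w \<le> ?W (n + 2) w * (ennreal C * ?F w)"
        by (intro mult_left_mono kernel_nn_two_step P C) auto
      then show "?W (n + 2) w * kernel_nn P ?F w \<le> ennreal C * (?W (n + 2) w * ?F w)"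
        by (simp add: ac_simps)
    qed
    then have first: "kernel_nn P (\<lambda>w. ?W (n + 2) w * kernel_nn P ?F w) x \<le> ennreal C * ?A (Suc n) x"
      by (simp add: kernel_nn_cmult)
    \<comment> \<open>All factors sit at \<open>z\<close>, so the two steps from \<open>x\<close>
      through \<open>w\<close> to \<open>z\<close> merge into one.\<close>
    have second: "kernel_nn P (kernel_nn P (\<lambda>z. ?W (n + 2) z * ?F z)) x \<le> ennreal C * ?A (Suc n) x"
      using kernel_nn_two_step[OF P C, of "\<lambda>z. ?W (n + 2) z * ?F z" x] by simp
    have "ennreal \<bar>(fk_op P V ^^ (Suc n + 2)) f x\<bar> \<le>
        ennreal (1 / V x) * kernel_nn P (\<lambda>w. ennreal \<bar>(fk_op P V ^^ (n + 2)) f w\<bar>) x"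
      using le[OF P0, where f = "(fk_op P V ^^ (n + 2)) f" and x = x] by simp
    also have "\<dots> \<le> ennreal (1 / V x) * kernel_nn P (\<lambda>w. ennreal ?D *
        (?W (n + 2) w * kernel_nn P ?F w + kernel_nn P (\<lambda>z. ?W (n + 2) z * ?F z) w)) x"
    proof (intro mult_left_mono kernel_nn_mono)
      fix w
      have D: "ennreal (?D * (1 / V w)) = ennreal ?D * ?W 1 w"
        using C(1) by (subst ennreal_mult') auto
      have "ennreal \<bar>(fk_op P V ^^ (n + 2)) f w\<bar> \<le> ennreal ?D * (?W 1 w * ?A n w)"
        using Suc.IH[of w] unfolding D mult.assoc .
      also have "\<dots> \<le> ennreal ?D *
        (?W (n + 2) w * kernel_nn P ?F w + kernel_nn P (\<lambda>z. ?W (n + 2) z * ?F z) w)"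
        by (intro mult_left_mono inner) auto
      finally show "ennreal \<bar>(fk_op P V ^^ (n + 2)) f w\<bar> \<le> \<dots>" .
    qed auto
    also have "\<dots> \<le> ennreal (1 / V x) * (ennreal ?D * (ennreal C * ?A (Suc n) x + ennreal C * ?A (Suc n) x))"
      unfolding kernel_nn_cmult kernel_nn_add
      by (intro mult_left_mono add_mono first second) auto
    also have "ennreal C * ?A (Suc n) x + ennreal C * ?A (Suc n) x = ennreal (2 * C) * ?A (Suc n) x"
    proof -
      have "ennreal (2 * C) = ennreal C + ennreal C"
        using C(1) by (simp flip: ennreal_plus)
      then show ?thesis by (simp only: distrib_right)
    qed
    also have "ennreal (1 / V x) * (ennreal ?D * (ennreal (2 * C) * ?A (Suc n) x)) =
        ennreal ((2 * C) ^ Suc n * (1 / V x)) * ?A (Suc n) x"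
    proof -
      have nn: "?D \<ge> 0" "2 * C \<ge> 0" "?D * (2 * C) \<ge> 0"
        using C(1) by auto
      have "(2 * C) ^ Suc n * (1 / V x) = 1 / V x * (?D * (2 * C))"
        by simp
      then show ?thesis
        by (simp only: ennreal_mult[OF W0 nn(3)] ennreal_mult[OF nn(1,2)] mult.assoc)
    qed
    finally show ?case .
  qed
qed

section \<open>Summability and embeddings of weighted \<open>l^p\<close> spaces\<close>

text \<open>Where \<open>g\<close> is at most 1 the term is at most \<open>k\<close>; elsewhere it
  is at most \<open>K * m * g^2\<close>. This is how the bound on \<open>P x y / \<mu> y\<close>
  makes the eigenfunction series converge.\<close>

lemma summable_on_kernel_mult:
  fixes k g m :: "'a \<Rightarrow> real"
  assumes "k summable_on UNIV" and k0: "\<And>y. k y \<ge> 0" and kK: "\<And>y. k y \<le> K * m y"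
    and g0: "\<And>y. g y \<ge> 0" and g: "g \<in> lp_space m 2"
  shows "(\<lambda>y. k y * g y) summable_on UNIV"
proof (rule summable_on_comparison_test)
  have "(\<lambda>y. (g y)\<^sup>2 * m y) summable_on UNIV"
    using g g0 by (simp add: lp_space_def)
  then show "(\<lambda>y. k y + K * ((g y)\<^sup>2 * m y)) summable_on UNIV"
    by (intro summable_on_add assms(1) summable_on_cmult_right)
next
  fix y
  have Km: "0 \<le> K * m y" using k0[of y] kK[of y] by linarith
  show "k y * g y \<le> k y + K * ((g y)\<^sup>2 * m y)"
  proof (cases "g y \<le> 1")
    case True
    then have "k y * g y \<le> k y" using k0 g0 by (simp add: mult_left_le)
    then show ?thesis using mult_nonneg_nonneg[OF Km, of "(g y)\<^sup>2"] by (simp add: ac_simps)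
  next
    case False
    then have "k y * g y \<le> (K * m y) * (g y)\<^sup>2"
      using k0[of y] kK[of y] Km g0[of y]
      by (intro mult_mono) (auto simp: power2_eq_square)
    then show ?thesis using k0[of y] by (simp add: ac_simps)
  qed
qed (simp add: k0 g0)

text \<open>Values of \<open>f\<close> are cut at a height \<open>s\<close>. The resulting constant
  is cruder than the one from Hoelder's inequality, but only finiteness matters.\<close>

lemma lp_space_1_embedding:
  fixes f :: "'a \<Rightarrow> 'b::real_normed_vector"
  assumes p: "p \<ge> 1" and m: "\<And>x. m x > 0" "m summable_on UNIV" and f: "f \<in> lp_space m p"
  shows "f \<in> lp_space m 1" and "lp_norm m 1 f \<le> (1 + infsum m UNIV) * lp_norm m p f"
proof -
  let ?S = "\<Sum>\<^sub>\<infinity>x. norm (f x) powr p * m x"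
  let ?t = "lp_norm m p f"
  have sm: "(\<lambda>x. norm (f x) powr p * m x) summable_on UNIV"
    using f by (simp add: lp_space_def)
  have nn: "norm (f x) powr p * m x \<ge> 0" for x using m(1)[of x] by simp
  have S0: "?S \<ge> 0" using nn by (rule infsum_nonneg)
  have m0: "infsum m UNIV \<ge> 0" using m(1) by (intro infsum_nonneg less_imp_le)
  \<comment> \<open>Summed over \<open>x\<close> with \<open>s\<close> the \<open>p\<close>-norm of \<open>f\<close>, this replaces Hoelder's inequality.\<close>
  have split: "norm (f x) * m x \<le> s powr (1 - p) * (norm (f x) powr p * m x) + s * m x"
    if s: "s > 0" for s x
  proof (cases "norm (f x) \<le> s")
    case True
    then show ?thesis
      using m(1)[of x] mult_nonneg_nonneg[OF powr_ge_zero nn[of x], of s "1 - p"]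
      by (intro add_increasing mult_right_mono) auto
  next
    case False
    then have "norm (f x) powr (1 - p) \<le> s powr (1 - p)"
      using s p by (intro powr_mono2') auto
    then have "norm (f x) powr (1 - p) * norm (f x) powr p \<le> s powr (1 - p) * norm (f x) powr p"
      by (intro mult_right_mono) auto
    moreover have "norm (f x) powr (1 - p) * norm (f x) powr p = norm (f x)"
      using False s by (simp flip: powr_add)
    ultimately have "norm (f x) * m x \<le> s powr (1 - p) * norm (f x) powr p * m x"
      using m(1)[of x] by (intro mult_right_mono) auto
    then show ?thesis
      using mult_pos_pos[OF s m(1)[of x]] unfolding mult.assoc by linarith
  qed
  have bd: "(\<lambda>x. s powr (1 - p) * (norm (f x) powr p * m x) + s * m x) summable_on UNIV" for s
    by (intro summable_on_add summable_on_cmult_right sm m(2))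
  have s1: "(\<lambda>x. norm (f x) * m x) summable_on UNIV"
    using split[of 1] m(1) by (intro summable_on_comparison_test[OF bd[of 1]]) (auto simp: less_imp_le)
  then show "f \<in> lp_space m 1" by (simp add: lp_space_def)
  have 1: "lp_norm m 1 f = (\<Sum>\<^sub>\<infinity>x. norm (f x) * m x)"
    using m(1) by (simp add: lp_norm_def infsum_nonneg less_imp_le)
  show "lp_norm m 1 f \<le> (1 + infsum m UNIV) * ?t"
  \<comment> \<open>The cut height \<open>?t\<close> must be positive, so the zero function is
    treated apart.\<close>
  proof (cases "?S = 0")
    case True
    have "f x = 0" for x
    proof -
      have "norm (f x) powr p * m x \<le> 0"
        using term_le_infsum[OF sm nn, of x] True by simp
      then show ?thesis
        using m(1)[of x] nn[of x] by (metis mult_eq_0_iff norm_eq_zero order_antisym order_less_irrefl powr_eq_0_iff)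
    qed
    then show ?thesis by (simp add: lp_norm_def)
  next
    case False
    then have S: "?S > 0" using S0 by simp
    then have t: "?t > 0" by (simp add: lp_norm_def)
    have "?S = ?t powr p" using S p by (simp add: lp_norm_def powr_powr)
    then have tS: "?t powr (1 - p) * ?S = ?t" using t by (simp flip: powr_add)
    have "lp_norm m 1 f \<le> (\<Sum>\<^sub>\<infinity>x. ?t powr (1 - p) * (norm (f x) powr p * m x) + ?t * m x)"
      unfolding 1 by (intro infsum_mono s1 bd split t)
    also have "\<dots> = ?t powr (1 - p) * ?S + ?t * infsum m UNIV"
      by (subst infsum_add) (auto intro: summable_on_cmult_right sm m(2) simp: infsum_cmult_right')
    finally show ?thesis unfolding tS by (simp only: distrib_right mult_1_left mult.commute[of ?t])
  qed
qed

lemma bounded_imp_lp_space: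
  fixes f :: "'a \<Rightarrow> 'b::real_normed_vector"
  assumes q: "q > 0" and m: "\<And>x. m x \<ge> 0" "m summable_on UNIV" and f: "\<And>x. norm (f x) \<le> M"
  shows "f \<in> lp_space m q" and "lp_norm m q f \<le> infsum m UNIV powr (1 / q) * M"
proof -
  have M0: "M \<ge> 0" using f norm_ge_zero order_trans by blast
  have bd: "(\<lambda>x. M powr q * m x) summable_on UNIV"
    by (intro summable_on_cmult_right m(2))
  have le: "norm (f x) powr q * m x \<le> M powr q * m x" for x
    using q f[of x] by (intro mult_right_mono powr_mono2 m(1)) auto
  have sm: "(\<lambda>x. norm (f x) powr q * m x) summable_on UNIV"
    using le m(1) by (intro summable_on_comparison_test[OF bd]) auto
  then show "f \<in> lp_space m q" by (simp add: lp_space_def)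
  have "(\<Sum>\<^sub>\<infinity>x. norm (f x) powr q * m x) \<le> M powr q * infsum m UNIV"
    using infsum_mono[OF sm bd le] by (simp add: infsum_cmult_right')
  then have "lp_norm m q f \<le> (M powr q * infsum m UNIV) powr (1 / q)"
    unfolding lp_norm_def using q m(1) by (intro powr_mono2 infsum_nonneg) auto
  also have "\<dots> = infsum m UNIV powr (1 / q) * M"
    using q M0 m(1) by (simp add: powr_mult infsum_nonneg powr_powr)
  finally show "lp_norm m q f \<le> infsum m UNIV powr (1 / q) * M" .
qed

lemma norm_le_linf_norm: "f \<in> linf_space \<Longrightarrow> norm (f x) \<le> linf_norm f"
  unfolding linf_space_def linf_norm_def
  by (intro cSUP_upper) (auto simp: bounded_iff intro: bdd_aboveI2)

text \<open>For finite measures the map factors through the inclusions of \<open>l^p\<close> into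
  \<open>l^1\<close> and of \<open>l^\<infinity>\<close> into \<open>l^q\<close>.\<close>

lemma bounded_between_lp_lq_if_ultracontractive:
  fixes T :: "('a \<Rightarrow> 'b::real_normed_vector) \<Rightarrow> 'c \<Rightarrow> 'd::real_normed_vector"
  assumes "bounded_between (lp_space m 1) (lp_norm m 1) linf_space linf_norm T"
    and m: "\<And>x. m x > 0" "m summable_on UNIV" and k: "\<And>x. k x \<ge> 0" "k summable_on UNIV"
    and p: "p \<ge> 1" and q: "q > 0"
  shows "bounded_between (lp_space m p) (lp_norm m p) (lp_space k q) (lp_norm k q) T"
proof -
  obtain C where C: "\<And>f. f \<in> lp_space m 1 \<Longrightarrow> T f \<in> linf_space"
    "\<And>f. f \<in> lp_space m 1 \<Longrightarrow> linf_norm (T f) \<le> C * lp_norm m 1 f"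
    using assms(1) unfolding bounded_between_def by blast
  let ?K = "infsum k UNIV powr (1 / q)" and ?M = "1 + infsum m UNIV"
  show ?thesis
    unfolding bounded_between_def
  \<comment> \<open>The definition of boundedness allows a negative \<open>C\<close>; the absolute
    value keeps the later multiplications monotone.\<close>
  proof (intro exI[of _ "?K * (\<bar>C\<bar> * ?M)"] ballI conjI)
    fix f :: "'a \<Rightarrow> 'b" assume f: "f \<in> lp_space m p"
    note f1 = lp_space_1_embedding[OF p m f]
    have "norm (T f x) \<le> \<bar>C\<bar> * ?M * lp_norm m p f" for x
    proof -
      have "norm (T f x) \<le> C * lp_norm m 1 f"
        using norm_le_linf_norm[OF C(1)[OF f1(1)], of x] C(2)[OF f1(1)] by linarith
      also have "\<dots> \<le> \<bar>C\<bar> * lp_norm m 1 f"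
        by (intro mult_right_mono) (auto simp: lp_norm_def)
      also have "\<dots> \<le> \<bar>C\<bar> * (?M * lp_norm m p f)"
        by (intro mult_left_mono f1(2)) auto
      finally show ?thesis by (simp add: mult.assoc)
    qed
    from bounded_imp_lp_space[OF q k this]
    show "T f \<in> lp_space k q" "lp_norm k q (T f) \<le> ?K * (\<bar>C\<bar> * ?M) * lp_norm m p f"
      by (simp_all add: mult.assoc)
  qed
qed

section \<open>Indicators of points and lower bounds on the diagonal\<close>

lemma lp_indicator:
  assumes "m x > 0"
  shows "(indicator {x} :: 'a \<Rightarrow> real) \<in> lp_space m p"
    and "lp_norm m p (indicator {x} :: 'a \<Rightarrow> real) = m x powr (1 / p)"
proof -
  let ?g = "\<lambda>y. norm (indicator {x} y :: real) powr p * m y"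
  have "(?g has_sum m x) {x}"
    using has_sum_finite[of "{x}" ?g] by simp
  \<comment> \<open>Off \<open>x\<close> the terms vanish because \<open>0 powr p = 0\<close> for
    every real \<open>p\<close>.\<close>
  then have "(?g has_sum m x) UNIV"
    by (rule has_sum_cong_neutral[THEN iffD1, rotated -1]) (auto simp: indicator_def)
  then show "(indicator {x} :: 'a \<Rightarrow> real) \<in> lp_space m p"
    "lp_norm m p (indicator {x} :: 'a \<Rightarrow> real) = m x powr (1 / p)"
    by (auto simp: lp_space_def lp_norm_def summable_on_def dest: infsumI)
qed

lemma norm_mult_powr_le_lp_norm:
  assumes "f \<in> lp_space m q" and q: "q > 0" and m: "\<And>x. m x \<ge> 0"
  shows "norm (f x) * m x powr (1 / q) \<le> lp_norm m q f"
proof -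
  have "norm (f x) powr q * m x \<le> (\<Sum>\<^sub>\<infinity>x. norm (f x) powr q * m x)"
    using assms by (intro term_le_infsum) (auto simp: lp_space_def)
  then have "(norm (f x) powr q * m x) powr (1 / q) \<le> lp_norm m q f"
    unfolding lp_norm_def using q m by (intro powr_mono2) auto
  then show ?thesis using q m by (simp add: powr_mult powr_powr)
qed

text \<open>The lower bound keeps only the path that stays at \<open>x\<close>. The upper bound is
  carried through the induction to ensure summability: a divergent series would have value 0 and
  destroy the lower bound.\<close>

lemma fk_op_iterate_ge_diagonal:
  fixes g :: "'a \<Rightarrow> real"
  assumes P: "sub_prob_kernel P" and V: "\<And>x. v \<le> V x" and v: "v > 0"
    and g: "\<And>x. 0 \<le> g x" "\<And>x. g x \<le> b"
  shows "0 \<le> (fk_op P V ^^ n) g x \<and> (fk_op P V ^^ n) g x \<le> b / v ^ n \<and>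
    (P x x / V x) ^ n * g x \<le> (fk_op P V ^^ n) g x"
proof (induction n arbitrary: x)
  case 0
  then show ?case using g by simp
next
  case (Suc n)
  let ?h = "(fk_op P V ^^ n) g"
  have P0: "P x y \<ge> 0" and Ps: "P x summable_on UNIV" and P1: "infsum (P x) UNIV \<le> 1" for x y
    using P by (auto simp: sub_prob_kernel_def)
  have b0: "b / v ^ n \<ge> 0" using Suc.IH order_trans by blast
  have bd: "(\<lambda>y. b / v ^ n * P x y) summable_on UNIV"
    by (intro summable_on_cmult_right Ps)
  have le: "P x y * ?h y \<le> b / v ^ n * P x y" for y
    using mult_left_mono[OF conjunct1[OF conjunct2[OF Suc.IH[of y]]] P0[of x y]] by (simp add: ac_simps)
  have nn: "0 \<le> P x y * ?h y" for y using P0 Suc.IH by simp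
  have sm: "(\<lambda>y. P x y * ?h y) summable_on UNIV"
    using le nn by (intro summable_on_comparison_test[OF bd])
  have W: "0 < 1 / V x" "1 / V x \<le> 1 / v" using V[of x] v by (auto simp: frac_le)
  have eq: "(fk_op P V ^^ Suc n) g x = 1 / V x * (\<Sum>\<^sub>\<infinity>y. P x y * ?h y)"
    by (simp add: fk_op_def)
  have "(\<Sum>\<^sub>\<infinity>y. P x y * ?h y) \<le> b / v ^ n * infsum (P x) UNIV"
    using infsum_mono[OF sm bd le] by (simp only: infsum_cmult_right')
  also have "\<dots> \<le> b / v ^ n" using b0 P1 by (rule mult_left_le[rotated])
  finally have "1 / V x * (\<Sum>\<^sub>\<infinity>y. P x y * ?h y) \<le> 1 / v * (b / v ^ n)"
    using W v by (intro mult_mono infsum_nonneg nn) auto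
  moreover have "(P x x / V x) ^ Suc n * g x \<le> 1 / V x * (\<Sum>\<^sub>\<infinity>y. P x y * ?h y)"
  proof -
    have "P x x * ((P x x / V x) ^ n * g x) \<le> P x x * ?h x"
      using Suc.IH P0 by (intro mult_left_mono) auto
    also have "\<dots> \<le> (\<Sum>\<^sub>\<infinity>y. P x y * ?h y)"
      using term_le_infsum[OF sm nn] .
    finally show ?thesis
      using mult_left_mono[of _ _ "1 / V x"] W(1) by (fastforce simp: ac_simps)
  qed
  moreover have "0 \<le> 1 / V x * (\<Sum>\<^sub>\<infinity>y. P x y * ?h y)"
    using W(1) by (intro mult_nonneg_nonneg[OF _ infsum_nonneg[OF nn]]) simp
  ultimately show ?case unfolding eq by simp
qed

text \<open>Finiteness of the intrinsic measure, from bounding the product of two square-summable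
  functions by the sum of their squares.\<close>

lemma summable_on_nu:
  assumes m: "\<And>x. m x \<ge> 0" and "\<And>x. \<phi> x \<ge> 0" "\<phi> \<in> lp_space m 2"
    and "\<And>x. \<psi> x \<ge> 0" "\<psi> \<in> lp_space m 2"
  shows "nu m \<phi> \<psi> summable_on UNIV"
proof (rule summable_on_comparison_test)
  show "(\<lambda>x. (\<phi> x)\<^sup>2 * m x + (\<psi> x)\<^sup>2 * m x) summable_on UNIV"
    using assms by (intro summable_on_add) (simp_all add: lp_space_def)
next
  fix x
  have "\<phi> x * \<psi> x \<le> (\<phi> x)\<^sup>2 + (\<psi> x)\<^sup>2"
    using sum_squares_bound[of "\<phi> x" "\<psi> x"] assms(2,4)[of x] mult_nonneg_nonneg[of "\<phi> x" "\<psi> x"]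
    by linarith
  from mult_right_mono[OF this m[of x]]
  show "nu m \<phi> \<psi> x \<le> (\<phi> x)\<^sup>2 * m x + (\<psi> x)\<^sup>2 * m x"
    by (simp add: nu_def distrib_right)
qed (simp add: nu_def assms)

text \<open>The indicator of \<open>x\<close> has 2-norm \<open>\<nu> x powr (1/2)\<close>, while
  the 4-norm of its image is at least \<open>d x * \<nu> x powr (1/4)\<close>. The gap
  \<open>1/2 - 1/4\<close> between the exponents yields the fourth power.\<close>

lemma hypercontractive_diagonal_bound:
  fixes \<nu> d :: "'a \<Rightarrow> real" and T :: "('a \<Rightarrow> real) \<Rightarrow> 'a \<Rightarrow> real"
  assumes T: "bounded_between (lp_space \<nu> 2) (lp_norm \<nu> 2) (lp_space \<nu> 4) (lp_norm \<nu> 4) T"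
    and \<nu>: "\<And>x. \<nu> x > 0"
    and d: "\<And>x. d x \<ge> 0" "\<And>x. d x \<le> T (indicator {x}) x"
  obtains K where "\<And>x. d x ^ 4 \<le> K * \<nu> x"
proof -
  obtain K where K: "\<And>f. f \<in> lp_space \<nu> 2 \<Longrightarrow> T f \<in> lp_space \<nu> 4"
    "\<And>f. f \<in> lp_space \<nu> 2 \<Longrightarrow> lp_norm \<nu> 4 (T f) \<le> K * lp_norm \<nu> 2 f"
    using T unfolding bounded_between_def by blast
  have "d x ^ 4 \<le> K ^ 4 * \<nu> x" for x
  proof -
    let ?f = "indicator {x} :: 'a \<Rightarrow> real"
    let ?r = "\<nu> x powr (1 / 4)"
    note f = lp_indicator[of \<nu> x, OF \<nu>]
    have r: "?r > 0" using \<nu>[of x] by simp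
    \<comment> \<open>The square root is written with the fourth root \<open>?r\<close> so that one
      factor \<open>?r\<close> cancels below.\<close>
    have rr: "\<nu> x powr (1 / 2) = ?r * ?r" using \<nu>[of x] by (simp flip: powr_add)
    have "d x * ?r \<le> norm (T ?f x) * ?r"
      using d(2)[of x] r by (intro mult_right_mono) auto
    also have "\<dots> \<le> lp_norm \<nu> 4 (T ?f)"
      using \<nu> by (intro norm_mult_powr_le_lp_norm K(1) f) (auto simp: less_imp_le)
    also have "\<dots> \<le> K * (?r * ?r)"
      using K(2)[OF f(1)] by (simp only: f(2) rr)
    finally have "d x \<le> K * ?r" using r by (simp flip: mult.assoc)
    then have "d x ^ 4 \<le> (K * ?r) ^ 4" using d(1) by (rule power_mono)
    also have "?r ^ 4 = \<nu> x" using \<nu>[of x] by (simp add: powr_power)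
    then have "(K * ?r) ^ 4 = K ^ 4 * \<nu> x" by (simp add: power_mult_distrib)
    finally show ?thesis .
  qed
  then show thesis by (rule that)
qed

section \<open>Equivalence of intrinsic ultracontractivity and hypercontractivity\<close>

theorem theorem4p10:
  fixes P Ph :: "'a \<Rightarrow> 'a \<Rightarrow> real"
    and \<mu> V \<phi> \<phi>h :: "'a \<Rightarrow> real"
    and C :: real
  assumes "countable (UNIV :: 'a set)" and "infinite (UNIV :: 'a set)"
    and "sub_prob_kernel P" and "sub_prob_kernel Ph"
    and "\<forall>x. \<mu> x > 0"
    and "\<forall>x y. \<mu> x * P x y = \<mu> y * Ph y x"
    and "potential V"
    and "\<forall>x y. P x y > 0"
    and "C \<ge> 1" and "\<forall>x y. two_step P x y \<le> C * P x y"
    and "(INF x. P x x) > 0"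
    and "bdd_above (range (\<lambda>(x, y). P x y / \<mu> y))"
    and "confining V"
    and "normalized_pos_eigenfunction \<mu> (fk_op P V) (lambda0 P V \<mu>) \<phi>"
    and "normalized_pos_eigenfunction \<mu> (fk_dual_op Ph V) (lambda0 P V \<mu>) \<phi>h"
  shows "aIUC P V \<mu> \<phi> \<phi>h \<longleftrightarrow> IHC P V \<mu> \<phi> \<phi>h"
proof -
  define l where "l = lambda0 P V \<mu>"
  define \<nu> where "\<nu> = nu \<mu> \<phi> \<phi>h"
  define v where "v = (INF x. V x)"
  define c where "c = (INF x. P x x)"
  have \<mu>: "\<mu> x > 0" and V0: "V x > 0" and P0: "P x y \<ge> 0" and Pp: "P x y > 0" and v: "v > 0"
    and c: "c > 0" and \<phi>: "\<phi> x > 0" "\<phi> \<in> lp_space \<mu> 2" "fk_op P V \<phi> x = l * \<phi> x"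
    and \<phi>h: "\<phi>h x > 0" "\<phi>h \<in> lp_space \<mu> 2" "fk_dual_op Ph V \<phi>h x = l * \<phi>h x"
    and dual: "\<mu> x * P x y = \<mu> y * Ph y x" for x y
    using assms by (auto simp: potential_def v_def c_def l_def normalized_pos_eigenfunction_def less_imp_le)
  have Vv: "v \<le> V x" for x
    unfolding v_def using V0 by (intro cINF_lower) (auto intro!: bdd_belowI2[of _ 0] less_imp_le)
  have Pc: "c \<le> P x x" for x
    unfolding c_def using P0 by (intro cINF_lower) (auto intro!: bdd_belowI2[of _ 0])
  obtain K where "\<And>x y. P x y / \<mu> y \<le> K"
    using assms(12) by (auto simp: bdd_above_def)
  then have K: "P x y \<le> K * \<mu> y" for x y
    using \<mu>[of y] by (simp add: divide_le_eq)
  have Ps: "P x summable_on UNIV" and Phs: "Ph x summable_on UNIV" and Ph0: "Ph x y \<ge> 0" for x y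
    using assms(3,4) by (auto simp: sub_prob_kernel_def)
  have \<nu>0: "\<nu> x > 0" for x using \<mu> \<phi>(1) \<phi>h(1) by (simp add: \<nu>_def nu_def)
  have \<nu>s: "\<nu> summable_on UNIV"
    unfolding \<nu>_def using \<mu> \<phi> \<phi>h by (intro summable_on_nu) (auto simp: less_imp_le)

  \<comment> \<open>Consequences of the two eigenvalue equations\<close>
  have sum\<phi>: "(\<lambda>y. P x y * \<phi> y) summable_on UNIV" for x
    using \<phi> P0 K by (intro summable_on_kernel_mult[OF Ps]) (auto simp: less_imp_le)
  have eig: "(\<Sum>\<^sub>\<infinity>y. P x y * \<phi> y) = l * V x * \<phi> x" for x
    using \<phi>(3)[of x] V0[of x] by (simp add: fk_op_def field_simps)
  \<comment> \<open>The diagonal term of the eigenvalue equation for \<open>\<phi>\<close> at any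
    point is already positive.\<close>
  have l: "l > 0"
  proof -
    fix x :: 'a
    have "0 < P x x * \<phi> x" using Pp \<phi>(1) by simp
    also have "\<dots> \<le> l * V x * \<phi> x"
      using term_le_infsum[OF sum\<phi>[of x], of x] P0 \<phi>(1) by (simp add: eig less_imp_le)
    finally show ?thesis using V0[of x] \<phi>(1)[of x] by (simp add: zero_less_mult_iff)
  qed
  \<comment> \<open>This is a single term of the eigenvalue equation of \<open>\<phi>h\<close> at
    \<open>y\<close>, multiplied by \<open>\<mu> y\<close> and rewritten from \<open>Ph\<close> to
    \<open>P\<close> by duality.\<close>
  have dual_eig: "\<phi>h z * \<mu> z * P z y / V z \<le> l * (\<phi>h y * \<mu> y)" for z y
  proof -
    have kernel: "Ph y z * (1 / V z) \<le> Ph y z * (1 / v)" for z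
      using Vv[of z] v Ph0 by (intro mult_left_mono frac_le) auto
    \<comment> \<open>Duality transfers the density bound: \<open>Ph y z\<close> is at most
      \<open>K * \<mu> z\<close> with the same \<open>K\<close>.\<close>
    have bound: "Ph y z * (1 / V z) \<le> K * (1 / v) * \<mu> z" for z
    proof -
      have "\<mu> y * Ph y z \<le> \<mu> y * (K * \<mu> z)"
        using mult_left_mono[OF K[of z y], of "\<mu> z"] \<mu>[of z] dual[of z y] by (simp add: ac_simps)
      then have "Ph y z \<le> K * \<mu> z" using \<mu>[of y] by simp
      from mult_right_mono[OF this, of "1 / v"] kernel[of z] v show ?thesis by (simp add: ac_simps)
    qed
    have ks: "(\<lambda>z. Ph y z * (1 / V z)) summable_on UNIV"
      using kernel V0 Ph0
      by (intro summable_on_comparison_test[OF summable_on_cmult_left[OF Phs, of y "1 / v"]])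
        (auto simp: less_imp_le)
    have nn: "0 \<le> Ph y z * (1 / V z)" for z
      using Ph0 V0[of z] by (intro mult_nonneg_nonneg) auto
    have "(\<lambda>z. Ph y z * (1 / V z) * \<phi>h z) summable_on UNIV"
      by (rule summable_on_kernel_mult[OF ks nn bound less_imp_le[OF \<phi>h(1)] \<phi>h(2)])
    then have "Ph y z * (1 / V z) * \<phi>h z \<le> (\<Sum>\<^sub>\<infinity>z. Ph y z * (1 / V z) * \<phi>h z)"
      by (rule term_le_infsum) (intro mult_nonneg_nonneg nn less_imp_le[OF \<phi>h(1)])
    also have "\<dots> = l * \<phi>h y"
      using \<phi>h(3)[of y] by (simp add: fk_dual_op_def)
    finally have "\<mu> y * Ph y z * (\<phi>h z / V z) \<le> l * (\<phi>h y * \<mu> y)"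
      using mult_left_mono[of _ _ "\<mu> y"] \<mu>[of y] by (fastforce simp: ac_simps)
    then show ?thesis by (simp add: ac_simps flip: dual)
  qed

  \<comment> \<open>From ultracontractivity to hypercontractivity\<close>
  have "IHC P V \<mu> \<phi> \<phi>h" if "aIUC P V \<mu> \<phi> \<phi>h"
    using that \<nu>0 \<nu>s unfolding aIUC_def IHC_def \<nu>_def[symmetric]
    by (meson bounded_between_lp_lq_if_ultracontractive less_imp_le less_trans zero_less_one)

  \<comment> \<open>From hypercontractivity to ultracontractivity\<close>
  moreover have "aIUC P V \<mu> \<phi> \<phi>h" if IHC: "IHC P V \<mu> \<phi> \<phi>h"
  proof -
    obtain n where T: "bounded_between (lp_space \<nu> 2) (lp_norm \<nu> 2) (lp_space \<nu> 4) (lp_norm \<nu> 4)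
        (intrinsic_op P V \<mu> \<phi> n)"
      using IHC[unfolded IHC_def, rule_format, of 2 4] unfolding \<nu>_def by auto
    obtain K' where K': "((c / (l * V x)) ^ n) ^ 4 \<le> K' * \<nu> x" for x
    proof (rule hypercontractive_diagonal_bound[OF T \<nu>0])
      fix x
      show "0 \<le> (c / (l * V x)) ^ n" using c l V0[of x] by simp
      let ?g = "\<lambda>y. indicator {x} y * \<phi> y :: real"
      have "(c / V x) ^ n * \<phi> x \<le> (P x x / V x) ^ n * ?g x"
        using Pc[of x] c V0[of x] \<phi>(1)[of x]
        by (simp, intro power_mono divide_right_mono) auto
      also have "\<dots> \<le> (fk_op P V ^^ n) ?g x"
      proof -
        \<comment> \<open>\<open>?g\<close> is supported at \<open>x\<close>, so
          \<open>\<phi> x\<close> serves as its upper bound \<open>b\<close>.\<close>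
        have "0 \<le> ?g y" "?g y \<le> \<phi> x" for y
          using \<phi>(1) by (auto simp: indicator_def less_imp_le)
        from fk_op_iterate_ge_diagonal[where V = V and g = ?g and n = n and x = x, OF assms(3) Vv v this]
        show ?thesis by blast
      qed
      finally have "(c / V x) ^ n * \<phi> x / (l ^ n * \<phi> x) \<le> intrinsic_op P V \<mu> \<phi> n (indicator {x}) x"
        unfolding intrinsic_op_def l_def[symmetric] using l \<phi>(1)[of x]
        by (intro divide_right_mono) auto
      then show "(c / (l * V x)) ^ n \<le> intrinsic_op P V \<mu> \<phi> n (indicator {x}) x"
        using \<phi>(1)[of x] by (simp add: power_divide power_mult_distrib mult.commute)
    qed blast
    define N where "N = n * 4"
    \<comment> \<open>The factor \<open>(l / c) ^ N\<close> undoes the normalisation in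
      \<open>c / (l * V x)\<close>.\<close>
    define A where "A = (l / c) ^ N * K'"
    have VN: "(1 / V x) ^ N \<le> A * \<nu> x" for x
    proof -
      have "(1 / V x) ^ N = (l / c) ^ N * (c / (l * V x)) ^ N"
        using l c by (simp flip: power_mult_distrib)
      also have "\<dots> \<le> (l / c) ^ N * (K' * \<nu> x)"
        using K'[of x] l c by (intro mult_left_mono) (auto simp: N_def power_mult)
      finally show ?thesis by (simp add: A_def mult.assoc)
    qed
    \<comment> \<open>\<open>K'\<close> comes without a sign; evaluating \<open>VN\<close> at one
      point supplies it.\<close>
    have A: "A \<ge> 0"
    proof -
      fix x
      have "0 \<le> A * \<nu> x" using VN[of x] V0[of x] by (auto intro: order_trans[rotated])
      then show ?thesis using \<nu>0[of x] by (simp add: zero_le_mult_iff)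
    qed
    \<comment> \<open>Of the \<open>N + 1\<close> factors at \<open>z\<close>, \<open>N\<close> are
      traded for \<open>A * \<nu> z\<close>; the last one supplies the \<open>1 / V z\<close> in
      \<open>dual_eig\<close>, which absorbs the part \<open>\<phi>h z * \<mu> z\<close> of
      \<open>\<nu> z\<close>. What remains separates the variables \<open>z\<close> and
      \<open>y\<close>.\<close>
    have kernel: "(1 / V z) ^ (N + 1) * P z y \<le> A * l * \<phi> z * (\<phi>h y * \<mu> y)" for z y
    proof -
      have "(1 / V z) ^ N * (P z y / V z) \<le> A * \<nu> z * (P z y / V z)"
        using P0 V0[of z] by (intro mult_right_mono VN) auto
      also have "\<dots> = A * \<phi> z * (\<phi>h z * \<mu> z * P z y / V z)"
        by (simp add: \<nu>_def nu_def)
      also have "\<dots> \<le> A * \<phi> z * (l * (\<phi>h y * \<mu> y))"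
        using A \<phi>(1)[of z] by (intro mult_left_mono dual_eig) auto
      finally show ?thesis by (simp add: ac_simps)
    qed
    \<comment> \<open>One factor \<open>l\<close> stems from \<open>kernel\<close>, the other from
      the eigenvalue equation of \<open>\<phi>\<close>.\<close>
    define D where "D = (2 * C) ^ N * (A * l\<^sup>2)"
    have main: "\<bar>(fk_op P V ^^ (N + 2)) (\<lambda>y. f y * \<phi> y) x\<bar> \<le> D * \<phi> x * lp_norm \<nu> 1 f"
      if f: "f \<in> lp_space \<nu> 1" for f :: "'a \<Rightarrow> real" and x
    proof -
      let ?S = "lp_norm \<nu> 1 f" and ?g = "\<lambda>y. f y * \<phi> y"
      have S0: "?S \<ge> 0" by (simp add: lp_norm_def)
      have S: "(\<integral>\<^sup>+y. ennreal (\<bar>f y\<bar> * \<nu> y) \<partial>count_space UNIV) = ennreal ?S"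
        using f \<nu>0
        by (subst nn_integral_count_space_conv_infsum)
          (auto simp: lp_space_def lp_norm_def less_imp_le infsum_nonneg)
      \<comment> \<open>The factor \<open>\<phi> y\<close> in \<open>?g\<close> combines with
        \<open>\<phi>h y * \<mu> y\<close> from \<open>kernel\<close> to \<open>\<nu> y\<close>, so
        the sum over \<open>y\<close> becomes the \<open>l^1\<close> norm of
        \<open>f\<close>.\<close>
      have inner: "ennreal ((1 / V z) ^ (N + 1)) * kernel_nn P (\<lambda>y. ennreal \<bar>?g y\<bar>) z
          \<le> ennreal (A * l * ?S) * ennreal (\<phi> z)" for z
      proof -
        have "ennreal ((1 / V z) ^ (N + 1)) * kernel_nn P (\<lambda>y. ennreal \<bar>?g y\<bar>) z =
            (\<integral>\<^sup>+y. ennreal ((1 / V z) ^ (N + 1) * P z y * \<bar>?g y\<bar>) \<partial>count_space UNIV)"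
          unfolding kernel_nn_def using P0 V0[of z]
          by (subst nn_integral_cmult[symmetric])
            (auto simp: ennreal_mult mult.assoc simp del: power_Suc power_one_over
              simp flip: Suc_eq_plus1 intro!: nn_integral_cong)
        also have "\<dots> \<le> (\<integral>\<^sup>+y. ennreal (A * l * \<phi> z * (\<bar>f y\<bar> * \<nu> y)) \<partial>count_space UNIV)"
        proof (intro nn_integral_mono ennreal_leI)
          fix y
          show "(1 / V z) ^ (N + 1) * P z y * \<bar>?g y\<bar> \<le> A * l * \<phi> z * (\<bar>f y\<bar> * \<nu> y)"
            using mult_right_mono[OF kernel[of z y], of "\<bar>?g y\<bar>"] \<phi>(1)[of y]
            by (simp add: abs_mult \<nu>_def nu_def ac_simps)
        qed
        also have "\<dots> = ennreal (A * l * \<phi> z) * ennreal ?S"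
          unfolding S[symmetric] using A l \<phi>(1)[of z] \<nu>0
          by (subst nn_integral_cmult[symmetric]) (auto simp: ennreal_mult' less_imp_le)
        also have "\<dots> = ennreal (A * l * ?S) * ennreal (\<phi> z)"
          using A l \<phi>(1)[of z] S0 by (simp add: ac_simps less_imp_le flip: ennreal_mult)
        finally show ?thesis .
      qed
      \<comment> \<open>The remaining sum over \<open>z\<close> is evaluated by the eigenvalue
        equation; its factor \<open>V x\<close> will cancel the outer
        \<open>1 / V x\<close>.\<close>
      have "kernel_nn P (\<lambda>z. ennreal (\<phi> z)) x = (\<integral>\<^sup>+y. ennreal (P x y * \<phi> y) \<partial>count_space UNIV)"
        unfolding kernel_nn_def using P0 by (simp add: ennreal_mult')
      also have "\<dots> = ennreal (l * V x * \<phi> x)"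
        using sum\<phi>[of x] P0 \<phi>(1) by (subst nn_integral_count_space_conv_infsum) (auto simp: eig less_imp_le)
      finally have P\<phi>: "kernel_nn P (\<lambda>z. ennreal (\<phi> z)) x = ennreal (l * V x * \<phi> x)" .
      have "ennreal \<bar>(fk_op P V ^^ (N + 2)) ?g x\<bar> \<le> ennreal ((2 * C) ^ N * (1 / V x)) *
          kernel_nn P (\<lambda>z. ennreal ((1 / V z) ^ (N + 1)) * kernel_nn P (\<lambda>y. ennreal \<bar>?g y\<bar>) z) x"
        using assms(9,10) V0 by (intro fk_op_iterate_bound assms(3)) auto
      also have "\<dots> \<le> ennreal ((2 * C) ^ N * (1 / V x)) *
          kernel_nn P (\<lambda>z. ennreal (A * l * ?S) * ennreal (\<phi> z)) x"
        by (intro mult_left_mono kernel_nn_mono inner) auto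
      also have "\<dots> = ennreal ((2 * C) ^ N * (1 / V x)) * (ennreal (A * l * ?S) * ennreal (l * V x * \<phi> x))"
        by (simp only: kernel_nn_cmult P\<phi>)
      also have "\<dots> = ennreal ((2 * C) ^ N * (1 / V x) * (A * l * ?S * (l * V x * \<phi> x)))"
        using assms(9) A l S0 V0[of x] \<phi>(1)[of x] by (simp add: less_imp_le flip: ennreal_mult)
      also have "(2 * C) ^ N * (1 / V x) * (A * l * ?S * (l * V x * \<phi> x)) = D * \<phi> x * ?S"
        using V0[of x] by (simp add: D_def power2_eq_square)
      finally show ?thesis
        using assms(9) A S0 \<phi>(1)[of x] by (subst (asm) ennreal_le_iff) (auto simp: D_def)
    qed
    have Q: "norm (intrinsic_op P V \<mu> \<phi> (N + 2) f x) \<le> D / l ^ (N + 2) * lp_norm \<nu> 1 f"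
      if f: "f \<in> lp_space \<nu> 1" for f :: "'a \<Rightarrow> real" and x
    proof -
      have "norm (intrinsic_op P V \<mu> \<phi> (N + 2) f x) =
          \<bar>(fk_op P V ^^ (N + 2)) (\<lambda>y. f y * \<phi> y) x\<bar> / (l ^ (N + 2) * \<phi> x)"
        using l \<phi>(1)[of x] by (simp add: intrinsic_op_def abs_mult flip: l_def)
      also have "\<dots> \<le> D * \<phi> x * lp_norm \<nu> 1 f / (l ^ (N + 2) * \<phi> x)"
        using l \<phi>(1)[of x] by (intro divide_right_mono main f) auto
      also have "\<dots> = D / l ^ (N + 2) * lp_norm \<nu> 1 f"
        using \<phi>(1)[of x] by simp
      finally show ?thesis .
    qed
    show ?thesis
      unfolding aIUC_def \<nu>_def[symmetric] bounded_between_def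
    proof (intro exI[of _ "N + 2"] exI[of _ "D / l ^ (N + 2)"] ballI conjI)
      fix f :: "'a \<Rightarrow> real" assume f: "f \<in> lp_space \<nu> 1"
      show "intrinsic_op P V \<mu> \<phi> (N + 2) f \<in> linf_space"
        unfolding linf_space_def bounded_iff using Q[OF f] by blast
      show "linf_norm (intrinsic_op P V \<mu> \<phi> (N + 2) f) \<le> D / l ^ (N + 2) * lp_norm \<nu> 1 f"
        unfolding linf_norm_def by (intro cSUP_least Q[OF f]) simp
    qed simp
  qed
  ultimately show ?thesis by blast
qed

end
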